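(* Let $r=p-1+\epsilon$ with $\epsilon>0$, let $$\Lambda= \frac{p-1+q}{r+q} \left(\frac{r-p+1}{r+q}\right)^{\frac{r-p+1}{p-1+q}} \frac{1}{\|b\|} \left(\frac{S^{r+q}}{\|a\|^{r-p+1}}\right)^{\frac{1}{p-1+q}},$$ let $\lambda\in(0,\Lambda)$, and let $W_\epsilon\in\mathcal N_\lambda^{-}$ be a solution of $$(P_\lambda)\quad -2\int_{\mathbb R^n}\frac{|w(y)-w(x)|^{p-2}(w(y)-w(x))}{|x-y|^{n+ps}}\,dy = a(x)w^{-q}+\lambda b(x)w^r \ \text{in } \Omega,\qquad w>0 \text{ in } \Omega,\qquad w=0 \text{ in } \mathbb R^n\setminus\Omega.$$ Then $$\|W_\epsilon\|>C_\epsilon\left(\frac{\Lambda}{\lambda}\right)^{\frac1\epsilon},\qquad\text{where}\qquad C_\epsilon=\left(1+\frac{p-1+q}{\epsilon}\right)^{\frac{1}{p-1+q}}\|a\|^{\frac{1}{p-1+q}}\left(\frac{1}{\sqrt[p]{S}}\right)^{\frac{1-q}{p-1+q}},$$ and $C_\epsilon\to\infty$ as $\epsilon\to0^+$.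
   Context: Standing assumptions: $s\in(0,1)$, $n>ps$, $\Omega\subset\mathbb R^n$ is a bounded domain with smooth boundary and $0\in\Omega$, $p_s^*=\frac{np}{n-ps}$, $0<q<1$, $q<p-1<r<p_s^*-1$. The function $a:\Omega\to\mathbb R$ satisfies $a>0$ and $a\in L^{\frac{p_s^*}{p_s^*-1+q}}(\Omega)$; $b:\Omega\to\mathbb R$ is sign-changing with $b^+\not\equiv0$ and $b\in L^{\frac{p_s^*}{p_s^*-1-r}}(\Omega)$. $\|a\|,\|b\|$ denote the norms of $a,b$ in these respective spaces. Let $Q=\mathbb R^{2n}\setminus((\mathbb R^n\setminus\Omega)\times(\mathbb R^n\setminus\Omega))$. $X_0$ is the space of measurable $w:\mathbb R^n\to\mathbb R$ with $w|_\Omega\in L^p(\Omega)$, $\frac{w(x)-w(y)}{|x-y|^{(n+ps)/p}}\in L^p(Q)$ and $w=0$ a.e. in $\mathbb R^n\setminus\Omega$, with the norm $\|w\|=\left(\int_Q\frac{|w(x)-w(y)|^p}{|x-y|^{n+ps}}\,dx\,dy\right)^{1/p}$. Put $$S=\inf_{w\in X_0\setminus\{0\}}\frac{\int_{\mathbb R^{2n}}|w(x)-w(y)|^p|x-y|^{-(n+ps)}\,dx\,dy}{\left(\int_{\mathbb R^n}|w|^{p_s^*}dx\right)^{p/p_s^*}}.$$ With $w_+=\max\{w,0\}$ and $\lambda>0$, let $$\mathcal N_\lambda=\left\{w\in X_0:\ \|w\|^p=\int_\Omega a\,w_+^{1-q}dx+\lambda\int_\Omega b\,w_+^{r+1}dx\right\},\quad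 \mathcal N_\lambda^{-}=\left\{w\in\mathcal N_\lambda: (p-1+q)\|w\|^p<\lambda(r+q)\int_\Omega b\,w_+^{r+1}dx\right\}.$$ A (weak) solution of $(P_\lambda)$ is $w\in X_0$ with $w>0$ in $\Omega$ such that for every $v\in X_0$ $$\int_Q\frac{|w(x)-w(y)|^{p-2}(w(x)-w(y))(v(x)-v(y))}{|x-y|^{n+ps}}dx\,dy=\int_\Omega a\,w^{-q}v\,dx+\lambda\int_\Omega b\,w^rv\,dx.$$ *)

theory Defs
  imports "HOL-Analysis.Analysis"
begin

text \<open>For open \<open>U\<close>: \<open>f\<close> has continuous partial derivatives of all orders up to \<open>k\<close> on \<open>U\<close>.\<close>

primrec C_k_on :: "nat \<Rightarrow> (real^'n) set \<Rightarrow> (real^'n \<Rightarrow> real) \<Rightarrow> bool" where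
  "C_k_on 0 U f \<longleftrightarrow> continuous_on U f"
| "C_k_on (Suc k) U f \<longleftrightarrow>
     (\<forall>x\<in>U. f differentiable at x) \<and>
     (\<forall>i\<in>Basis. C_k_on k U (\<lambda>x. frechet_derivative f (at x) i))"

definition C_infinity_on :: "(real^'n) set \<Rightarrow> (real^'n \<Rightarrow> real) \<Rightarrow> bool" where
  "C_infinity_on U f \<longleftrightarrow> (\<forall>k. C_k_on k U f)"

text \<open>Near each boundary point, \<open>\<Omega>\<close> is the region where a smooth local defining function with
  nonvanishing gradient is negative.\<close>

definition smooth_boundary :: "(real^'n) set \<Rightarrow> bool" where
  "smooth_boundary \<Omega> \<longleftrightarrow>
     (\<forall>z\<in>frontier \<Omega>. \<exists>U \<phi>. open U \<and> z \<in> U \<and> C_infinity_on U \<phi> \<and>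
        (\<forall>x\<in>U. frechet_derivative \<phi> (at x) \<noteq> (\<lambda>_. 0)) \<and>
        \<Omega> \<inter> U = {x\<in>U. \<phi> x < 0})"

definition bounded_smooth_domain :: "(real^'n) set \<Rightarrow> bool" where
  "bounded_smooth_domain \<Omega> \<longleftrightarrow>
     open \<Omega> \<and> connected \<Omega> \<and> \<Omega> \<noteq> {} \<and> bounded \<Omega> \<and> smooth_boundary \<Omega>"

text \<open>Functions on \<open>A\<close> are total functions of which only the values on \<open>A\<close> matter; they are not
  quotiented by equality almost everywhere.\<close>

definition Lp_on :: "real \<Rightarrow> 'a::euclidean_space set \<Rightarrow> ('a \<Rightarrow> real) set" where
  "Lp_on t A = {f. set_borel_measurable lebesgue A f \<and>
                   set_integrable lebesgue A (\<lambda>x. \<bar>f x\<bar> powr t)}"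

definition Lp_norm_on :: "real \<Rightarrow> 'a::euclidean_space set \<Rightarrow> ('a \<Rightarrow> real) \<Rightarrow> real" where
  "Lp_norm_on t A f = (LINT x:A|lebesgue. \<bar>f x\<bar> powr t) powr (1 / t)"

definition crit_exp :: "nat \<Rightarrow> real \<Rightarrow> real \<Rightarrow> real" where
  "crit_exp n s p = real n * p / (real n - p * s)"

definition Q_set :: "(real^'n) set \<Rightarrow> ((real^'n) \<times> (real^'n)) set" where
  "Q_set \<Omega> = UNIV - (UNIV - \<Omega>) \<times> (UNIV - \<Omega>)"

definition X0 :: "real \<Rightarrow> real \<Rightarrow> (real^'n) set \<Rightarrow> (real^'n \<Rightarrow> real) set" where
  "X0 s p \<Omega> = {w. w \<in> borel_measurable lebesgue \<and>
      w \<in> Lp_on p \<Omega> \<and>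
      (\<lambda>(x, y). (w x - w y) / norm (x - y) powr ((real CARD('n) + p * s) / p)) \<in> Lp_on p (Q_set \<Omega>) \<and>
      (AE x in lebesgue. x \<notin> \<Omega> \<longrightarrow> w x = 0)}"

definition X0_norm :: "real \<Rightarrow> real \<Rightarrow> (real^'n) set \<Rightarrow> (real^'n \<Rightarrow> real) \<Rightarrow> real" where
  "X0_norm s p \<Omega> w =
     (LINT z:Q_set \<Omega>|lebesgue.
        (case z of (x, y) \<Rightarrow> \<bar>w x - w y\<bar> powr p / norm (x - y) powr (real CARD('n) + p * s)))
     powr (1 / p)"

text \<open>The zero element of \<open>X\<^sub>0\<close> is the class of functions vanishing almost everywhere.\<close>

definition Sob_const :: "real \<Rightarrow> real \<Rightarrow> (real^'n) set \<Rightarrow> real" where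
  "Sob_const s p \<Omega> =
     Inf {(LINT z|lebesgue.
             (case z of (x, y) \<Rightarrow>
                \<bar>w x - w y\<bar> powr p * norm (x - y) powr (- (real CARD('n) + p * s)))) /
          (LINT x|lebesgue. \<bar>w x\<bar> powr crit_exp CARD('n) s p) powr (p / crit_exp CARD('n) s p)
         | w. w \<in> X0 s p \<Omega> \<and> \<not> (AE x in lebesgue. w x = 0)}"

definition Nehari ::
  "real \<Rightarrow> real \<Rightarrow> real \<Rightarrow> real \<Rightarrow> (real^'n) set \<Rightarrow> (real^'n \<Rightarrow> real) \<Rightarrow> (real^'n \<Rightarrow> real) \<Rightarrow> real
    \<Rightarrow> (real^'n \<Rightarrow> real) set" where
  "Nehari s p q r \<Omega> a b lam = {w \<in> X0 s p \<Omega>.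
     X0_norm s p \<Omega> w powr p =
       (LINT x:\<Omega>|lebesgue. a x * (max (w x) 0) powr (1 - q))
       + lam * (LINT x:\<Omega>|lebesgue. b x * (max (w x) 0) powr (r + 1))}"

definition Nehari_minus ::
  "real \<Rightarrow> real \<Rightarrow> real \<Rightarrow> real \<Rightarrow> (real^'n) set \<Rightarrow> (real^'n \<Rightarrow> real) \<Rightarrow> (real^'n \<Rightarrow> real) \<Rightarrow> real
    \<Rightarrow> (real^'n \<Rightarrow> real) set" where
  "Nehari_minus s p q r \<Omega> a b lam = {w \<in> Nehari s p q r \<Omega> a b lam.
     (p - 1 + q) * X0_norm s p \<Omega> w powr p
       < lam * (r + q) * (LINT x:\<Omega>|lebesgue. b x * (max (w x) 0) powr (r + 1))}"

text \<open>The singular term \<open>a w\<^sup>-\<^sup>q v\<close> need not be integrable for \<open>w, v \<in> X\<^sub>0\<close>, and the Bochner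
  integral of a non-integrable function is \<open>0\<close>; its integrability is therefore part of the
  weak formulation. The other two integrands are integrable by Hoelder's inequality.\<close>

definition weak_solution ::
  "real \<Rightarrow> real \<Rightarrow> real \<Rightarrow> real \<Rightarrow> (real^'n) set \<Rightarrow> (real^'n \<Rightarrow> real) \<Rightarrow> (real^'n \<Rightarrow> real) \<Rightarrow> real
    \<Rightarrow> (real^'n \<Rightarrow> real) \<Rightarrow> bool" where
  "weak_solution s p q r \<Omega> a b lam w \<longleftrightarrow>
     w \<in> X0 s p \<Omega> \<and> (AE x in lebesgue. x \<in> \<Omega> \<longrightarrow> 0 < w x) \<and>
     (\<forall>v\<in>X0 s p \<Omega>.
        set_integrable lebesgue \<Omega> (\<lambda>x. a x * w x powr (- q) * v x) \<and>
        (LINT z:Q_set \<Omega>|lebesgue.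
           (case z of (x, y) \<Rightarrow>
              \<bar>w x - w y\<bar> powr (p - 2) * (w x - w y) * (v x - v y)
                / norm (x - y) powr (real CARD('n) + p * s)))
        = (LINT x:\<Omega>|lebesgue. a x * w x powr (- q) * v x)
          + lam * (LINT x:\<Omega>|lebesgue. b x * w x powr r * v x))"

definition a_norm :: "real \<Rightarrow> real \<Rightarrow> real \<Rightarrow> (real^'n) set \<Rightarrow> (real^'n \<Rightarrow> real) \<Rightarrow> real" where
  "a_norm s p q \<Omega> a =
     Lp_norm_on (crit_exp CARD('n) s p / (crit_exp CARD('n) s p - 1 + q)) \<Omega> a"

definition b_norm :: "real \<Rightarrow> real \<Rightarrow> real \<Rightarrow> (real^'n) set \<Rightarrow> (real^'n \<Rightarrow> real) \<Rightarrow> real" where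
  "b_norm s p r \<Omega> b =
     Lp_norm_on (crit_exp CARD('n) s p / (crit_exp CARD('n) s p - 1 - r)) \<Omega> b"

definition Lambda_const ::
  "real \<Rightarrow> real \<Rightarrow> real \<Rightarrow> real \<Rightarrow> (real^'n) set \<Rightarrow> (real^'n \<Rightarrow> real) \<Rightarrow> (real^'n \<Rightarrow> real) \<Rightarrow> real" where
  "Lambda_const s p q r \<Omega> a b =
     (p - 1 + q) / (r + q)
     * ((r - p + 1) / (r + q)) powr ((r - p + 1) / (p - 1 + q))
     * (1 / b_norm s p r \<Omega> b)
     * (Sob_const s p \<Omega> powr (r + q) / a_norm s p q \<Omega> a powr (r - p + 1)) powr (1 / (p - 1 + q))"

definition C_const ::
  "real \<Rightarrow> real \<Rightarrow> real \<Rightarrow> (real^'n) set \<Rightarrow> (real^'n \<Rightarrow> real) \<Rightarrow> real \<Rightarrow> real" where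
  "C_const s p q \<Omega> a \<epsilon> =
     (1 + (p - 1 + q) / \<epsilon>) powr (1 / (p - 1 + q))
     * a_norm s p q \<Omega> a powr (1 / (p - 1 + q))
     * (1 / Sob_const s p \<Omega> powr (1 / p)) powr ((1 - q) / (p - 1 + q))"

end

(* Write k for the critical exponent. For W in the lower part of the Nehari manifold,
   (p - 1 + q) |W|^p < lam (r + q) int b W_+^(r+1). Hoelder's inequality bounds the integral by |b|
   times the L^k norm of W to the power r + 1, and the definition of S bounds that norm by
   (|W|^p / S)^(1/p). Cancelling |W|^p leaves a lower bound for |W|^epsilon, whose epsilon-th root is
   C_epsilon (Lambda / lam)^(1 / epsilon).

   The divergence of C_epsilon rests on S > 0, the fractional Sobolev inequality. For bounded u >= 0
   with A = int u^k, Chebyshev's inequality shows that u <= u x / 2 on half of a ball around x of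
   volume comparable to A / (u x)^k, so that the Gagliardo integrand at x integrates to at least
   c (u x)^k A^(-ps/n). Integrating over x gives A^(1 - ps/n) <= C K, where K is the Gagliardo energy
   of u; truncation removes the boundedness. *)

theory Submission
  imports Defs "HOL-Real_Asymp.Real_Asymp"
begin

section \<open>The fractional Sobolev inequality\<close>

text \<open>The integrand of \<open>Sob_const\<close> over a general Euclidean space. Since
  \<open>0 powr t\<close> is \<open>0\<close>, it vanishes on the diagonal.\<close>

definition gagliardo :: "real \<Rightarrow> real \<Rightarrow> ('a::euclidean_space \<Rightarrow> real) \<Rightarrow> 'a \<times> 'a \<Rightarrow> real" where
  "gagliardo s p w = (\<lambda>(x, y). \<bar>w x - w y\<bar> powr p * norm (x - y) powr (- (real DIM('a) + p * s)))"

lemma gagliardo_nonneg: "0 \<le> gagliardo s p w z"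
  by (simp add: gagliardo_def split: prod.split)

lemma gagliardo_measurable [measurable]:
  fixes w :: "'a::euclidean_space \<Rightarrow> real"
  assumes [measurable]: "w \<in> borel_measurable borel"
  shows "gagliardo s p w \<in> borel_measurable (lborel \<Otimes>\<^sub>M lborel)"
  unfolding gagliardo_def by measurable

lemma gagliardo_mono:
  assumes "\<bar>u x - u y\<bar> \<le> \<bar>w x - w y\<bar>" "0 \<le> p"
  shows "gagliardo s p u (x, y) \<le> gagliardo s p w (x, y)"
  using assms by (auto simp: gagliardo_def intro!: mult_right_mono powr_mono2)

text \<open>Where \<open>c \<le> u x\<close>, the quotient \<open>u x / c\<close> is at least 1 and
  so is its k-th power; hence the indicator is dominated by a multiple of the integrand.\<close>

lemma Chebyshev_powr:
  fixes u :: "'a::euclidean_space \<Rightarrow> real"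
  assumes [measurable]: "u \<in> borel_measurable borel"
    and A: "(\<integral>\<^sup>+x. ennreal (u x powr k) \<partial>lborel) = ennreal A" "0 \<le> A"
    and c: "0 < c" and k: "0 \<le> k"
  shows "emeasure lborel {x. c \<le> u x} \<le> ennreal (A * (1 / c) powr k)"
proof -
  have [measurable]: "{x. c \<le> u x} \<in> sets lborel" by measurable
  have "emeasure lborel {x. c \<le> u x} = (\<integral>\<^sup>+x. indicator {x. c \<le> u x} x \<partial>lborel)"
    by simp
  also have "\<dots> \<le> (\<integral>\<^sup>+x. ennreal ((1 / c) powr k) * ennreal (u x powr k) \<partial>lborel)"
  proof (rule nn_integral_mono)
    fix x
    show "indicator {x. c \<le> u x} x \<le> ennreal ((1 / c) powr k) * ennreal (u x powr k)"
    proof (cases "c \<le> u x")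
      case True
      have "(1 / c) powr k * u x powr k = (u x / c) powr k"
        using c True by (simp add: powr_mult[symmetric])
      also have "\<dots> \<ge> 1" using c True k by (intro ge_one_powr_ge_zero) auto
      finally show ?thesis using True by (simp add: ennreal_mult[symmetric])
    qed auto
  qed
  also have "\<dots> = ennreal ((1 / c) powr k) * ennreal A"
    by (simp add: nn_integral_cmult A)
  also have "\<dots> = ennreal (A * (1 / c) powr k)"
    using A by (simp add: ennreal_mult[symmetric] mult.commute)
  finally show ?thesis .
qed

lemma crit_exp_pos:
  assumes "0 < p" "p * s < real n" "0 \<le> s"
  shows "0 < crit_exp n s p"
proof -
  have "0 \<le> p * s" using assms by simp
  then have "0 < real n" using assms by linarith
  then show ?thesis using assms by (auto simp: crit_exp_def)
qed

text \<open>For the critical exponent \<open>k\<close> this is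
  \<open>k * (1 - p * s / n) = p\<close>. It lets the powers of \<open>u x / 2\<close> in the next
  lemma recombine to a single k-th power.\<close>

lemma crit_exp_fixed_point:
  assumes "0 < n" "p * s < real n"
  shows "p + crit_exp n s p * (p * s / real n) = crit_exp n s p"
  using assms by (simp add: crit_exp_def field_simps)

text \<open>On the part \<open>B\<close> of a ball around \<open>x\<close> where \<open>u\<close> is
  below \<open>u x / 2\<close>, the numerator is at least \<open>(u x / 2) powr p\<close> and the
  distance at most \<open>\<rho>\<close>. So the inner integral is at least a constant times the
  measure of \<open>B\<close>. Where \<open>u x = 0\<close>, the left side is
  \<open>0\<close>.\<close>

lemma powr_crit_exp_le_gagliardo:
  fixes u :: "'a::euclidean_space \<Rightarrow> real"
  assumes sp: "0 \<le> s" "0 < p" "p * s < real DIM('a)"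
    and [measurable]: "u \<in> borel_measurable borel" and u0: "\<And>x. 0 \<le> u x"
    and A: "(\<integral>\<^sup>+x. ennreal (u x powr crit_exp DIM('a) s p) \<partial>lborel) = ennreal A" "0 < A"
  defines "\<theta> \<equiv> p * s / real DIM('a)"
  shows "ennreal (u x powr crit_exp DIM('a) s p)
     \<le> ennreal (2 powr crit_exp DIM('a) s p * (2 / unit_ball_vol (real DIM('a))) powr (1 + \<theta>) * A powr \<theta>)
       * (\<integral>\<^sup>+y. ennreal (gagliardo s p u (x, y)) \<partial>lborel)"
proof (cases "u x = 0")
  case False
  define k where "k = crit_exp DIM('a) s p"
  define \<omega> where "\<omega> = unit_ball_vol (real DIM('a))"
  define t where "t = u x / 2"
  define m where "m = A * (1 / t) powr k"
  \<comment> \<open>This radius gives the ball measure \<open>2 * m\<close>, twice the Chebyshev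
    bound \<open>m\<close> for \<open>E\<close>.\<close>
  define \<rho> where "\<rho> = (2 * m / \<omega>) powr (1 / real DIM('a))"
  define E where "E = {y. t \<le> u y}"
  define B where "B = ball x \<rho> - E"
  have t: "0 < t" using False u0[of x] by (simp add: t_def)
  have \<omega>: "0 < \<omega>" by (simp add: \<omega>_def)
  have m: "0 < m" using t A by (simp add: m_def)
  have \<rho>: "0 < \<rho>" using m \<omega> by (simp add: \<rho>_def)
  have k: "0 < k" unfolding k_def using sp by (intro crit_exp_pos) auto
  have [measurable]: "E \<in> sets borel" unfolding E_def by measurable
  have [measurable]: "B \<in> sets borel" unfolding B_def by measurable
  have E: "emeasure lborel E \<le> ennreal m"
    unfolding E_def m_def using A t k by (intro Chebyshev_powr) (auto simp: k_def)
  have "\<rho> ^ DIM('a) = 2 * m / \<omega>"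
    using m \<omega> by (simp add: \<rho>_def powr_powr flip: powr_realpow)
  then have ball: "emeasure lborel (ball x \<rho>) = ennreal (2 * m)"
    using \<rho> \<omega> by (simp add: emeasure_ball flip: \<omega>_def)
  \<comment> \<open>Since \<open>E\<close> has measure at most \<open>m\<close>, cancelling one
    finite \<open>m\<close> leaves measure at least \<open>m\<close> for \<open>B\<close>.\<close>
  have "ennreal m + ennreal m = emeasure lborel (ball x \<rho>)"
    using m by (simp add: ball flip: ennreal_plus)
  also have "\<dots> \<le> emeasure lborel (B \<union> E)"
    by (intro emeasure_mono) (auto simp: B_def)
  also have "\<dots> \<le> emeasure lborel B + ennreal m"
    using emeasure_subadditive[of B lborel E] E by (simp add: add_left_mono order_trans)
  finally have "ennreal m + ennreal m \<le> ennreal m + emeasure lborel B"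
    by (simp only: add.commute)
  then have B: "ennreal m \<le> emeasure lborel B"
    unfolding ennreal_add_left_cancel_le by simp
  define c where "c = t powr p * \<rho> powr (- (real DIM('a) + p * s))"
  have "ennreal (c * m) \<le> ennreal c * emeasure lborel B"
    using B m by (simp add: c_def ennreal_mult mult_left_mono)
  also have "\<dots> = (\<integral>\<^sup>+y. ennreal c * indicator B y \<partial>lborel)"
    by (simp add: nn_integral_cmult)
  also have "\<dots> \<le> (\<integral>\<^sup>+y. ennreal (gagliardo s p u (x, y)) \<partial>lborel)"
  proof (rule nn_integral_mono)
    fix y
    show "ennreal c * indicator B y \<le> ennreal (gagliardo s p u (x, y))"
    proof (cases "y \<in> B")
      case True
      then have y: "u y < t" "norm (x - y) \<le> \<rho>" by (auto simp: B_def E_def dist_norm)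
      then have "y \<noteq> x" using t t_def by auto
      have "t powr p \<le> \<bar>u x - u y\<bar> powr p"
        using y t sp by (intro powr_mono2) (auto simp: t_def)
      moreover have "\<rho> powr (- (real DIM('a) + p * s)) \<le> norm (x - y) powr (- (real DIM('a) + p * s))"
        using y \<open>y \<noteq> x\<close> sp by (intro powr_mono2') (auto intro: order_trans[of _ 0])
      ultimately have "c \<le> gagliardo s p u (x, y)"
        unfolding c_def gagliardo_def by (auto intro!: mult_mono)
      then show ?thesis using True by (simp add: ennreal_leI)
    qed auto
  qed
  finally have g: "ennreal (c * m) \<le> (\<integral>\<^sup>+y. ennreal (gagliardo s p u (x, y)) \<partial>lborel)" .
  have \<theta>: "real DIM('a) + p * s = real DIM('a) * (1 + \<theta>)"
    by (simp add: \<theta>_def field_simps)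
  have "\<rho> powr (- (real DIM('a) + p * s)) = (2 * m / \<omega>) powr (- (1 + \<theta>))"
    unfolding \<rho>_def powr_powr \<theta> by simp
  then have "c * m = t powr p * (m powr (- (1 + \<theta>)) * m powr 1) * (2 / \<omega>) powr (- (1 + \<theta>))"
    using m \<omega> unfolding c_def by (simp add: powr_mult[symmetric] mult_ac)
  \<comment> \<open>The total exponent of \<open>m\<close> is \<open>- \<theta>\<close>, and
    \<open>m\<close> is \<open>A\<close> times the power \<open>- k\<close> of
    \<open>t\<close>.\<close>
  also have "m powr (- (1 + \<theta>)) * m powr 1 = A powr (- \<theta>) * t powr (k * \<theta>)"
    using A t unfolding powr_add[symmetric] m_def by (simp add: powr_mult powr_powr powr_divide powr_minus divide_simps)
  finally have "c * m = A powr (- \<theta>) * (t powr p * t powr (k * \<theta>)) * (2 / \<omega>) powr (- (1 + \<theta>))"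
    by simp
  also have "t powr p * t powr (k * \<theta>) = t powr k"
    using crit_exp_fixed_point[of "DIM('a)" p s] sp unfolding powr_add[symmetric] k_def \<theta>_def by simp
  finally have cm: "c * m = A powr (- \<theta>) * t powr k * (2 / \<omega>) powr (- (1 + \<theta>))" .
  \<comment> \<open>The constant of the statement inverts every factor of \<open>c * m\<close>
    except \<open>t powr k\<close>; its \<open>2 powr k\<close> turns \<open>t powr k\<close> back
    into \<open>u x powr k\<close>.\<close>
  have "2 powr k * (2 / \<omega>) powr (1 + \<theta>) * A powr \<theta> * (c * m)
      = 2 powr k * t powr k * ((2 / \<omega>) powr (1 + \<theta>) * (2 / \<omega>) powr (- (1 + \<theta>))) * (A powr \<theta> * A powr (- \<theta>))"
    unfolding cm by (simp only: mult_ac)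
  also have "\<dots> = 2 powr k * t powr k"
    using A \<omega> unfolding powr_add[symmetric] by simp
  finally have C: "2 powr k * (2 / \<omega>) powr (1 + \<theta>) * A powr \<theta> * (c * m) = 2 powr k * t powr k" .
  have "u x powr k = 2 powr k * t powr k"
    using t by (simp add: t_def powr_divide)
  also have "\<dots> = 2 powr k * (2 / \<omega>) powr (1 + \<theta>) * A powr \<theta> * (c * m)"
    by (rule C[symmetric])
  finally have "ennreal (u x powr k) = ennreal (2 powr k * (2 / \<omega>) powr (1 + \<theta>) * A powr \<theta>) * ennreal (c * m)"
    using m by (simp add: c_def ennreal_mult[symmetric])
  also have "\<dots> \<le> ennreal (2 powr k * (2 / \<omega>) powr (1 + \<theta>) * A powr \<theta>) * (\<integral>\<^sup>+y. ennreal (gagliardo s p u (x, y)) \<partial>lborel)"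
    using g by (intro mult_left_mono) auto
  finally show ?thesis by (simp add: k_def \<omega>_def)
qed simp

text \<open>Integrating the pointwise estimate over \<open>x\<close> gives
  \<open>A \<le> C * A powr \<theta> * K\<close>, and dividing by \<open>A powr \<theta>\<close>
  bounds \<open>A\<close>. The result is independent of \<open>M\<close>, which is what truncation
  requires.\<close>

lemma fractional_sobolev_bounded:
  fixes u :: "'a::euclidean_space \<Rightarrow> real"
  assumes sp: "0 \<le> s" "0 < p" "p * s < real DIM('a)"
    and [measurable]: "u \<in> borel_measurable borel" and u0: "\<And>x. 0 \<le> u x" and uM: "\<And>x. u x \<le> M"
    and fin: "emeasure lborel {x. u x \<noteq> 0} < \<infinity>"
    and K: "(\<integral>\<^sup>+z. ennreal (gagliardo s p u z) \<partial>lborel) \<le> ennreal K" "0 \<le> K"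
  defines "k \<equiv> crit_exp DIM('a) s p" and "\<theta> \<equiv> p * s / real DIM('a)"
  shows "(\<integral>\<^sup>+x. ennreal (u x powr k) \<partial>lborel)
    \<le> ennreal ((2 powr k * (2 / unit_ball_vol (real DIM('a))) powr (1 + \<theta>) * K) powr (k / p))"
proof -
  define C where "C = 2 powr k * (2 / unit_ball_vol (real DIM('a))) powr (1 + \<theta>)"
  have k: "0 < k" unfolding k_def using sp by (intro crit_exp_pos) auto
  \<comment> \<open>Boundedness of \<open>u\<close> and the finite measure of the set where it is
    nonzero make \<open>A\<close> finite, so that its power may be absorbed.\<close>
  have "(\<integral>\<^sup>+x. ennreal (u x powr k) \<partial>lborel) \<le> (\<integral>\<^sup>+x. ennreal (M powr k) * indicator {x. u x \<noteq> 0} x \<partial>lborel)"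
    using k u0 uM by (intro nn_integral_mono) (auto simp: indicator_def intro!: ennreal_leI powr_mono2)
  also have "\<dots> = ennreal (M powr k) * emeasure lborel {x. u x \<noteq> 0}"
    by (subst nn_integral_cmult) auto
  also have "\<dots> < \<infinity>" using fin by (simp add: ennreal_mult_less_top)
  finally obtain A where A: "(\<integral>\<^sup>+x. ennreal (u x powr k) \<partial>lborel) = ennreal A" "0 \<le> A"
    by (cases "\<integral>\<^sup>+x. ennreal (u x powr k) \<partial>lborel") auto
  show ?thesis
  proof (cases "A = 0")
    case False
    with A have A0: "0 < A" by simp
    have "ennreal A = (\<integral>\<^sup>+x. ennreal (u x powr k) \<partial>lborel)" using A by simp
    also have "\<dots> \<le> (\<integral>\<^sup>+x. ennreal (C * A powr \<theta>) * (\<integral>\<^sup>+y. ennreal (gagliardo s p u (x, y)) \<partial>lborel) \<partial>lborel)"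
      unfolding C_def k_def \<theta>_def using A A0 u0 sp 
      by (intro nn_integral_mono powr_crit_exp_le_gagliardo) (auto simp: k_def)
    also have "\<dots> = ennreal (C * A powr \<theta>) * (\<integral>\<^sup>+x. (\<integral>\<^sup>+y. ennreal (gagliardo s p u (x, y)) \<partial>lborel) \<partial>lborel)"
      by (subst nn_integral_cmult) auto
    also have "(\<integral>\<^sup>+x. (\<integral>\<^sup>+y. ennreal (gagliardo s p u (x, y)) \<partial>lborel) \<partial>lborel)
        = (\<integral>\<^sup>+z. ennreal (gagliardo s p u z) \<partial>lborel)"
      unfolding lborel_prod[symmetric] by (rule lborel.nn_integral_fst) measurable
    also have "ennreal (C * A powr \<theta>) * \<dots> \<le> ennreal (C * A powr \<theta>) * ennreal K"
      using K by (intro mult_left_mono) auto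
    also have "\<dots> = ennreal (C * A powr \<theta> * K)"
      using K by (simp add: C_def ennreal_mult)
    finally have "A \<le> C * A powr \<theta> * K"
      using K by (subst (asm) ennreal_le_iff) (auto simp: C_def)
    then have "A powr (1 - \<theta>) \<le> C * K"
      using A0 by (simp add: powr_diff field_simps)
    \<comment> \<open>The exponent \<open>k / p\<close> is the inverse of
      \<open>1 - \<theta>\<close>.\<close>
    moreover have "(1 - \<theta>) * (k / p) = 1"
      using sp by (simp add: \<theta>_def k_def crit_exp_def field_simps)
    ultimately have "A \<le> (C * K) powr (k / p)"
      using powr_mono2[of "k / p" "A powr (1 - \<theta>)" "C * K"] A0 k sp(2)
      unfolding powr_powr \<open>(1 - \<theta>) * (k / p) = 1\<close> by simp
    then show ?thesis using A by (simp add: C_def ennreal_leI)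
  qed (use A in auto)
qed

text \<open>Cutting the absolute value of \<open>w\<close> at height \<open>i\<close> does not
  increase differences, hence not the energy. The bound is therefore uniform in \<open>i\<close>,
  and monotone convergence removes the cut.\<close>

lemma fractional_sobolev:
  fixes w :: "'a::euclidean_space \<Rightarrow> real"
  assumes sp: "0 \<le> s" "0 < p" "p * s < real DIM('a)"
    and [measurable]: "w \<in> borel_measurable borel"
    and fin: "emeasure lborel {x. w x \<noteq> 0} < \<infinity>"
    and K: "(\<integral>\<^sup>+z. ennreal (gagliardo s p w z) \<partial>lborel) \<le> ennreal K" "0 \<le> K"
  defines "k \<equiv> crit_exp DIM('a) s p" and "\<theta> \<equiv> p * s / real DIM('a)"
  shows "(\<integral>\<^sup>+x. ennreal (\<bar>w x\<bar> powr k) \<partial>lborel)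
    \<le> ennreal ((2 powr k * (2 / unit_ball_vol (real DIM('a))) powr (1 + \<theta>) * K) powr (k / p))"
    (is "_ \<le> ?R")
proof (rule LIMSEQ_le_const2)
  define u where "u i x = min \<bar>w x\<bar> (real i)" for i x
  have k: "0 < k" unfolding k_def using sp by (intro crit_exp_pos) auto
  have [measurable]: "u i \<in> borel_measurable borel" for i unfolding u_def by measurable
  show "(\<lambda>i. \<integral>\<^sup>+x. ennreal (u i x powr k) \<partial>lborel) \<longlonglongrightarrow> (\<integral>\<^sup>+x. ennreal (\<bar>w x\<bar> powr k) \<partial>lborel)"
  proof (rule nn_integral_LIMSEQ)
    show "incseq (\<lambda>i x. ennreal (u i x powr k))"
      using k by (auto simp: incseq_def le_fun_def u_def intro!: ennreal_leI powr_mono2)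
    show "(\<lambda>i. ennreal (u i x powr k)) \<longlonglongrightarrow> ennreal (\<bar>w x\<bar> powr k)" for x
    proof (rule tendsto_eventually)
      obtain N where "\<bar>w x\<bar> \<le> real N" using real_arch_simple by blast
      then show "\<forall>\<^sub>F i in sequentially. ennreal (u i x powr k) = ennreal (\<bar>w x\<bar> powr k)"
        by (intro eventually_sequentiallyI[of N]) (simp add: u_def)
    qed
  qed measurable
  have "(\<integral>\<^sup>+x. ennreal (u i x powr k) \<partial>lborel) \<le> ?R" for i
    unfolding k_def \<theta>_def
  proof (rule fractional_sobolev_bounded[where M = "real i"])
    show "emeasure lborel {x. u i x \<noteq> 0} < \<infinity>"
      by (rule le_less_trans[OF emeasure_mono fin]) (auto simp: u_def)
    have "gagliardo s p (u i) z \<le> gagliardo s p w z" for z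
      by (cases z) (use sp in \<open>auto intro!: gagliardo_mono simp: u_def\<close>)
    then have "(\<integral>\<^sup>+z. ennreal (gagliardo s p (u i) z) \<partial>lborel) \<le> (\<integral>\<^sup>+z. ennreal (gagliardo s p w z) \<partial>lborel)"
      by (intro nn_integral_mono ennreal_leI)
    with K show "(\<integral>\<^sup>+z. ennreal (gagliardo s p (u i) z) \<partial>lborel) \<le> ennreal K" by simp
  qed (use sp K in \<open>auto simp: u_def\<close>)
  then show "\<exists>N. \<forall>i\<ge>N. (\<integral>\<^sup>+x. ennreal (u i x powr k) \<partial>lborel) \<le> ?R" by blast
qed

section \<open>Finite Gagliardo energy of a tent function\<close>

lemma nn_integral_lborel_diff:
  fixes f :: "'a::euclidean_space \<Rightarrow> ennreal"
  assumes [measurable]: "f \<in> borel_measurable borel"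
  shows "(\<integral>\<^sup>+y. f (y - x) \<partial>lborel) = (\<integral>\<^sup>+y. f y \<partial>lborel)"
proof -
  have "(\<integral>\<^sup>+y. f y \<partial>lborel) = (\<integral>\<^sup>+y. f y \<partial>distr lborel borel ((+) (- x)))"
    by (simp add: lborel_distr_plus)
  also have "\<dots> = (\<integral>\<^sup>+y. f (y - x) \<partial>lborel)"
    by (subst nn_integral_distr) auto
  finally show ?thesis by simp
qed

text \<open>The integer part of the binary logarithm selects the dyadic shell of a point.\<close>

lemma ex_two_power_bounds:
  fixes x :: real
  assumes "1 \<le> x"
  shows "\<exists>k::nat. 2 powr real k \<le> x \<and> x \<le> 2 powr (real k + 1)"
proof -
  have "0 \<le> log 2 x" using assms by simp
  then have "real (nat \<lfloor>log 2 x\<rfloor>) \<le> log 2 x" "log 2 x \<le> real (nat \<lfloor>log 2 x\<rfloor>) + 1"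
    by linarith+
  then show ?thesis
    using assms by (intro exI[of _ "nat \<lfloor>log 2 x\<rfloor>"]) (simp add: powr_le_iff le_powr_iff)
qed

text \<open>The k-th ball contributes its weight times a fixed multiple of its radius to the power
  of the dimension, so the third assumption turns the sum of integrals into a geometric
  series.\<close>

lemma nn_integral_suminf_cballs_less_top:
  fixes c x :: real and g \<rho> :: "nat \<Rightarrow> real"
  assumes "\<And>k. 0 \<le> g k" "\<And>k. 0 \<le> \<rho> k" 
    and "\<And>k. g k * \<rho> k ^ DIM('a) = c * x ^ k" "0 \<le> c" "0 \<le> x" "x < 1"
  shows "(\<integral>\<^sup>+h. (\<Sum>k. ennreal (g k) * indicator (cball (0::'a::euclidean_space) (\<rho> k)) h) \<partial>lborel) < \<infinity>"
proof -
  define \<omega> where "\<omega> = unit_ball_vol (real DIM('a))"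
  have \<omega>: "0 \<le> \<omega>" by (simp add: \<omega>_def)
  have "(\<integral>\<^sup>+h. (\<Sum>k. ennreal (g k) * indicator (cball (0::'a) (\<rho> k)) h) \<partial>lborel)
    = (\<Sum>k. \<integral>\<^sup>+h. ennreal (g k) * indicator (cball (0::'a) (\<rho> k)) h \<partial>lborel)"
    by (intro nn_integral_suminf borel_measurable_times_ennreal borel_measurable_indicator borel_measurable_const) auto
  also have "\<dots> = (\<Sum>k. ennreal (\<omega> * c * x ^ k))"
  proof (rule suminf_cong)
    fix k
    have "(\<integral>\<^sup>+h. ennreal (g k) * indicator (cball (0::'a) (\<rho> k)) h \<partial>lborel)
        = ennreal (g k) * ennreal (\<omega> * \<rho> k ^ DIM('a))"
      using assms by (simp add: nn_integral_cmult_indicator emeasure_cball \<omega>_def)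
    also have "\<dots> = ennreal (\<omega> * (g k * \<rho> k ^ DIM('a)))"
      using assms \<omega> by (simp add: ennreal_mult[symmetric] mult_ac)
    finally show "(\<integral>\<^sup>+h. ennreal (g k) * indicator (cball (0::'a) (\<rho> k)) h \<partial>lborel)
        = ennreal (\<omega> * c * x ^ k)"
      by (simp add: assms mult_ac)
  qed
  also have "\<dots> \<noteq> top"
    using assms \<omega> by (intro ennreal_suminf_neq_top summable_mult summable_geometric) auto
  finally show ?thesis by (simp add: top.not_eq_extremum)
qed

text \<open>Near the origin the kernel has order \<open>p - DIM('a) - p * s\<close>, integrable
  because \<open>s < 1\<close>; far away it has order \<open>- DIM('a) - p * s\<close>, integrable
  because \<open>0 < s\<close>. Dyadic balls replace polar coordinates.\<close>

lemma truncated_kernel_integral_less_top: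
  assumes "0 < s" "s < 1" "0 < p"
  shows "(\<integral>\<^sup>+h. ennreal (min 1 (norm h) powr p * norm h powr (- (real DIM('a) + p * s))) \<partial>(lborel :: 'a::euclidean_space measure)) < \<infinity>"
proof -
  define e where "e = real DIM('a) + p * s"
  \<comment> \<open>Majorant inside the unit ball. If \<open>norm h\<close> lies between
    \<open>2 powr (- (k + 1))\<close> and \<open>2 powr (- k)\<close>, the two factors of the k-th
    weight bound \<open>norm h powr p\<close> and \<open>norm h powr (- e)\<close>.\<close>
  define F where "F h = (\<Sum>k. ennreal (2 powr (- real k * p) * 2 powr ((real k + 1) * e)) * indicator (cball (0::'a) (2 powr (- real k))) h)" for h
  \<comment> \<open>Majorant outside the unit ball, for \<open>norm h\<close> between
    \<open>2 powr k\<close> and \<open>2 powr (k + 1)\<close>. Taking full balls instead of shells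
    only enlarges it.\<close>
  define G where "G h = (\<Sum>k. ennreal (2 powr (- real k * e)) * indicator (cball (0::'a) (2 powr (real k + 1))) h)" for h
  have e: "0 < e" using assms by (simp add: e_def add_pos_pos)
  have [measurable]: "cball (0::'a) t \<in> sets borel" for t by simp
  have le_suminf: "f k \<le> (\<Sum>k. f k)" for f :: "nat \<Rightarrow> ennreal" and k
    using sum_le_suminf[OF summableI, of "{k}" f] by simp
  have "ennreal (min 1 (norm h) powr p * norm h powr (- e)) \<le> F h + G h" for h :: 'a
  proof (cases "h = 0 \<or> 1 \<le> norm h")
    case True
    show ?thesis
    proof (cases "h = 0")
      case False
      with True obtain k :: nat where k: "2 powr real k \<le> norm h" "norm h \<le> 2 powr (real k + 1)"
        using ex_two_power_bounds by blast
      have "norm h powr (- e) \<le> (2 powr real k) powr (- e)"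
        using k e by (intro powr_mono2') auto
      then have "ennreal (min 1 (norm h) powr p * norm h powr (- e))
          \<le> ennreal (2 powr (- real k * e)) * indicator (cball 0 (2 powr (real k + 1))) h"
        using k False True by (simp add: powr_powr ennreal_leI)
      also have "\<dots> \<le> G h" unfolding G_def by (rule le_suminf)
      finally show ?thesis by (simp add: add_increasing)
    qed simp
  next
    case False
    then obtain k :: nat where k: "2 powr real k \<le> 1 / norm h" "1 / norm h \<le> 2 powr (real k + 1)"
      using ex_two_power_bounds[of "1 / norm h"] by auto
    have h: "0 < norm h" using False by simp
    have k': "norm h \<le> 2 powr (- real k)" "2 powr (- (real k + 1)) \<le> norm h"
      using k h by (simp_all only: powr_minus) (simp_all add: field_simps)
    have "norm h powr (- e) \<le> (2 powr (- (real k + 1))) powr (- e)"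
      using k' e h by (intro powr_mono2') auto
    moreover have "norm h powr p \<le> (2 powr (- real k)) powr p"
      using k' assms h by (intro powr_mono2) auto
    ultimately have "norm h powr p * norm h powr (- e) \<le> 2 powr (- real k * p) * 2 powr ((real k + 1) * e)"
      unfolding powr_powr by (intro mult_mono) (auto simp: algebra_simps)
    then have "ennreal (min 1 (norm h) powr p * norm h powr (- e))
        \<le> ennreal (2 powr (- real k * p) * 2 powr ((real k + 1) * e)) * indicator (cball 0 (2 powr (- real k))) h"
      using False k' by (simp add: ennreal_leI)
    also have "\<dots> \<le> F h" unfolding F_def by (rule le_suminf)
    finally show ?thesis by (simp add: add_increasing2)
  qed
  then have "(\<integral>\<^sup>+h. ennreal (min 1 (norm h) powr p * norm h powr (- e)) \<partial>(lborel :: 'a measure)) \<le> (\<integral>\<^sup>+h. F h + G h \<partial>lborel)"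
    by (intro nn_integral_mono)
  also have "\<dots> = (\<integral>\<^sup>+h. F h \<partial>lborel) + (\<integral>\<^sup>+h. G h \<partial>lborel)"
    unfolding F_def G_def by (intro nn_integral_add) measurable
  also have "\<dots> < \<infinity>"
  proof -
    have "(\<integral>\<^sup>+h. F h \<partial>lborel) < \<infinity>" unfolding F_def
    \<comment> \<open>Weight times volume has exponent \<open>k * (- p + e - DIM('a))\<close> up to
      a constant; the ratio is below 1 because \<open>s < 1\<close>.\<close>
    proof (rule nn_integral_suminf_cballs_less_top[where c = "2 powr e" and x = "2 powr (- p * (1 - s))"])
      show "2 powr (- real k * p) * 2 powr ((real k + 1) * e) * (2 powr - real k) ^ DIM('a)
          = 2 powr e * (2 powr (- p * (1 - s))) ^ k" for k
      proof -
        have "- real k * p + (real k + 1) * e + real DIM('a) * (- real k) = e + real k * (- p * (1 - s))"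
          unfolding e_def by algebra
        then show ?thesis by (simp only: powr_power powr_add[symmetric])
      qed
      show "2 powr (- p * (1 - s)) < (1::real)" using assms by (intro powr_less_one) auto
    qed auto
    moreover have "(\<integral>\<^sup>+h. G h \<partial>lborel) < \<infinity>" unfolding G_def
    \<comment> \<open>Here the exponent is \<open>k * (DIM('a) - e)\<close> up to a constant, and
      \<open>0 < s\<close> makes the ratio less than 1.\<close>
    proof (rule nn_integral_suminf_cballs_less_top[where c = "2 powr real DIM('a)" and x = "2 powr (- p * s)"])
      show "2 powr (- real k * e) * (2 powr (real k + 1)) ^ DIM('a)
          = 2 powr real DIM('a) * (2 powr (- p * s)) ^ k" for k
      proof -
        have "- real k * e + real DIM('a) * (real k + 1) = real DIM('a) + real k * (- p * s)"
          unfolding e_def by algebra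
        then show ?thesis by (simp only: powr_power powr_add[symmetric])
      qed
      show "2 powr (- p * s) < (1::real)" using assms by (intro powr_less_one) auto
    qed auto
    ultimately show ?thesis by simp
  qed
  finally show ?thesis by (simp add: e_def)
qed

text \<open>The tent is 1-Lipschitz with values in the unit interval, so its differences are at most
  \<open>min 1 (norm (x - y))\<close>, and they vanish unless \<open>x\<close> or \<open>y\<close>
  lies in a fixed ball. Each of the two cases costs the truncated kernel integral times the volume
  of that ball.\<close>

lemma tent_gagliardo_less_top:
  fixes \<delta> :: real
  assumes "0 < s" "s < 1" "0 < p" and \<delta>: "0 < \<delta>" "\<delta> \<le> 1"
  shows "(\<integral>\<^sup>+z. ennreal (gagliardo s p (\<lambda>x::'a::euclidean_space. max 0 (\<delta> - norm x)) z) \<partial>lborel) < \<infinity>"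
proof -
  define H :: "'a \<Rightarrow> ennreal" where "H h = ennreal (min 1 (norm h) powr p * norm h powr (- (real DIM('a) + p * s)))" for h
  define I where "I = (\<integral>\<^sup>+h. H h \<partial>lborel)"
  define B where "B = ball (0::'a) \<delta>"
  let ?\<phi> = "\<lambda>x::'a. max 0 (\<delta> - norm x)"
  have I: "I < \<infinity>" using truncated_kernel_integral_less_top[OF assms(1-3)] by (simp add: I_def H_def)
  have [measurable]: "H \<in> borel_measurable borel" "B \<in> sets borel"
    unfolding H_def B_def by measurable
  have even: "H (x - y) = H (y - x)" for x y
    by (simp add: H_def norm_minus_commute)
  have int: "(\<integral>\<^sup>+y. H (y - x) \<partial>lborel) = I" for x
    unfolding I_def by (rule nn_integral_lborel_diff) simp
  have "ennreal (gagliardo s p ?\<phi> (x, y)) \<le> indicator B x * H (y - x) + indicator B y * H (y - x)" for x y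
  proof (cases "x \<in> B \<or> y \<in> B")
    case True
    have "\<bar>norm x - norm y\<bar> \<le> norm (x - y)" by (rule norm_triangle_ineq3)
    then have "\<bar>?\<phi> x - ?\<phi> y\<bar> \<le> min 1 (norm (x - y))"
      using \<delta> by (smt (verit) norm_ge_zero)
    then have "\<bar>?\<phi> x - ?\<phi> y\<bar> powr p \<le> min 1 (norm (x - y)) powr p"
      using assms by (intro powr_mono2) auto
    then have "ennreal (gagliardo s p ?\<phi> (x, y)) \<le> H (y - x)"
      unfolding even[symmetric] by (auto simp: gagliardo_def H_def intro!: ennreal_leI mult_right_mono)
    with True show ?thesis by (auto simp: indicator_def intro: order_trans)
  qed (auto simp: gagliardo_def B_def)
  then have "(\<integral>\<^sup>+z. ennreal (gagliardo s p ?\<phi> z) \<partial>lborel)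
      \<le> (\<integral>\<^sup>+z. (case z of (x, y) \<Rightarrow> indicator B x * H (y - x) + indicator B y * H (y - x)) \<partial>lborel)"
    by (intro nn_integral_mono) (auto split: prod.split)
  also have "\<dots> = (\<integral>\<^sup>+x. (\<integral>\<^sup>+y. indicator B x * H (y - x) + indicator B y * H (y - x) \<partial>lborel) \<partial>lborel)"
    unfolding lborel_prod[symmetric]
    by (subst lborel.nn_integral_fst[symmetric]) auto
  also have "\<dots> = (\<integral>\<^sup>+x. (\<integral>\<^sup>+y. indicator B x * H (y - x) \<partial>lborel) \<partial>lborel)
      + (\<integral>\<^sup>+x. (\<integral>\<^sup>+y. indicator B y * H (y - x) \<partial>lborel) \<partial>lborel)"
    by (simp add: nn_integral_add)
  \<comment> \<open>After the exchange \<open>x\<close> is integrated first, and evenness of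
    \<open>H\<close> with translation invariance makes the inner integral \<open>I\<close>.\<close>
  also have "(\<integral>\<^sup>+x. (\<integral>\<^sup>+y. indicator B y * H (y - x) \<partial>lborel) \<partial>lborel)
      = (\<integral>\<^sup>+y. (\<integral>\<^sup>+x. indicator B y * H (y - x) \<partial>lborel) \<partial>lborel)"
    by (rule lborel_pair.Fubini') measurable
  also have "\<dots> = (\<integral>\<^sup>+y. I * indicator B y \<partial>lborel)"
    by (subst even) (simp add: nn_integral_cmult int mult.commute)
  also have "(\<integral>\<^sup>+x. (\<integral>\<^sup>+y. indicator B x * H (y - x) \<partial>lborel) \<partial>lborel) = (\<integral>\<^sup>+y. I * indicator B y \<partial>lborel)"
    by (simp add: nn_integral_cmult int mult.commute)
  also have "(\<integral>\<^sup>+y. I * indicator B y \<partial>lborel) = I * emeasure lborel B"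
    by (simp add: nn_integral_cmult_indicator)
  also have "I * emeasure lborel B + I * emeasure lborel B < \<infinity>"
    using I \<delta> by (simp add: B_def emeasure_ball ennreal_mult_less_top)
  finally show ?thesis .
qed

section \<open>Hoelder's inequality\<close>

text \<open>Young's inequality is applied to \<open>f\<close> and \<open>g\<close> divided by their
  norms and then integrated.\<close>

lemma integral_powr_Holder:
  fixes f g :: "'a \<Rightarrow> real"
  assumes [measurable]: "f \<in> borel_measurable M" "g \<in> borel_measurable M"
    and pq: "1 < p" "1 < q" "1 / p + 1 / q = 1"
    and f: "integrable M (\<lambda>x. \<bar>f x\<bar> powr p)" and g: "integrable M (\<lambda>x. \<bar>g x\<bar> powr q)"
  shows "(\<integral>x. f x * g x \<partial>M) \<le> (\<integral>x. \<bar>f x\<bar> powr p \<partial>M) powr (1 / p) * (\<integral>x. \<bar>g x\<bar> powr q \<partial>M) powr (1 / q)"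
proof -
  define F where "F = (\<integral>x. \<bar>f x\<bar> powr p \<partial>M)"
  define G where "G = (\<integral>x. \<bar>g x\<bar> powr q \<partial>M)"
  have FG0: "0 \<le> F" "0 \<le> G" by (auto simp: F_def G_def)
  show ?thesis
  proof (cases "F = 0 \<or> G = 0")
    \<comment> \<open>Normalization is impossible here, but one of the factors vanishes almost
      everywhere.\<close>
    case True
    then have "AE x in M. f x * g x = 0"
      using integral_nonneg_eq_0_iff_AE[OF f] integral_nonneg_eq_0_iff_AE[OF g]
      by (auto simp: F_def G_def elim: AE_mp)
    then have "(\<integral>x. f x * g x \<partial>M) = 0" by (subst integral_cong_AE[where g = "\<lambda>_. 0"]) auto
    then show ?thesis by simp
  next
    case False
    with FG0 have FG: "0 < F" "0 < G" by auto
    define c where "c = F powr (1 / p) * G powr (1 / q)"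
    have c: "0 < c" using FG by (simp add: c_def)
    have young: "\<bar>f x * g x\<bar> \<le> c * (\<bar>f x\<bar> powr p / (F * p) + \<bar>g x\<bar> powr q / (G * q))" for x
    proof -
      have "(\<bar>f x\<bar> / F powr (1 / p)) * (\<bar>g x\<bar> / G powr (1 / q))
        \<le> (\<bar>f x\<bar> / F powr (1 / p)) powr p / p + (\<bar>g x\<bar> / G powr (1 / q)) powr q / q"
        using pq by (intro Youngs_inequality) auto
      also have "\<dots> = \<bar>f x\<bar> powr p / (F * p) + \<bar>g x\<bar> powr q / (G * q)"
        using FG pq by (simp add: powr_divide powr_powr)
      finally show ?thesis
        using c FG by (simp add: c_def abs_mult field_simps)
    qed
    have int: "integrable M (\<lambda>x. c * (\<bar>f x\<bar> powr p / (F * p) + \<bar>g x\<bar> powr q / (G * q)))"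
      using f g by simp
    have "(\<integral>x. f x * g x \<partial>M) \<le> (\<integral>x. c * (\<bar>f x\<bar> powr p / (F * p) + \<bar>g x\<bar> powr q / (G * q)) \<partial>M)"
    \<comment> \<open>Young's bound also yields integrability of the product, as monotonicity of the
      Bochner integral requires.\<close>
    proof (rule integral_mono[OF Bochner_Integration.integrable_bound[OF int] int])
      show "AE x in M. norm (f x * g x) \<le> norm (c * (\<bar>f x\<bar> powr p / (F * p) + \<bar>g x\<bar> powr q / (G * q)))"
        using young by (auto intro!: AE_I2 order_trans[OF young abs_ge_self])
      show "f x * g x \<le> c * (\<bar>f x\<bar> powr p / (F * p) + \<bar>g x\<bar> powr q / (G * q))" for x
        using young[of x] by linarith
    qed measurable
    also have "\<dots> = c * (F / (F * p) + G / (G * q))"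
      using f g by (simp add: F_def G_def)
    also have "\<dots> = c" using FG pq by simp
    finally show ?thesis by (simp add: c_def F_def G_def)
  qed
qed

text \<open>\<open>Lp_on\<close> controls its members only on \<open>A\<close>, so the previous
  inequality is applied to their products with the indicator of \<open>A\<close>.\<close>

lemma set_integral_powr_Holder:
  fixes f g :: "'a::euclidean_space \<Rightarrow> real"
  assumes A: "A \<in> sets lebesgue" and f: "f \<in> Lp_on p A" and g: "g \<in> Lp_on q A"
    and pq: "1 < p" "1 < q" "1 / p + 1 / q = 1"
  shows "(LINT x:A|lebesgue. f x * g x) \<le> Lp_norm_on p A f * Lp_norm_on q A g"
proof -
  have eq: "\<bar>indicator A x *\<^sub>R h x\<bar> powr t = indicator A x *\<^sub>R (\<bar>h x\<bar> powr t)" for h :: "'a \<Rightarrow> real" and t x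
    by (simp add: indicator_def)
  have "(LINT x|lebesgue. (indicator A x *\<^sub>R f x) * (indicator A x *\<^sub>R g x))
     \<le> (LINT x|lebesgue. \<bar>indicator A x *\<^sub>R f x\<bar> powr p) powr (1 / p) * (LINT x|lebesgue. \<bar>indicator A x *\<^sub>R g x\<bar> powr q) powr (1 / q)"
    using f g pq unfolding Lp_on_def
    by (intro integral_powr_Holder) (auto simp only: eq set_borel_measurable_def set_integrable_def)
  also have "(\<lambda>x. (indicator A x *\<^sub>R f x) * (indicator A x *\<^sub>R g x)) = (\<lambda>x. indicator A x *\<^sub>R (f x * g x))"
    by (auto simp: indicator_def)
  finally show ?thesis
    unfolding eq Lp_norm_on_def set_lebesgue_integral_def .
qed

section \<open>The space and its Sobolev constant\<close>

text \<open>Lebesgue measure on the product is the completion of the Borel product measure. The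
  exceptional set is therefore first enlarged to a Borel null set \<open>N\<close>, whose two
  cylinders are null in the product.\<close>

lemma AE_lebesgue_pair:
  fixes P :: "'a::euclidean_space \<Rightarrow> bool"
  assumes "AE x in lebesgue. P x"
  shows "AE z in lebesgue. P (fst z) \<and> P (snd z)"
proof -
  from assms have "AE x in lborel. P x" by (simp add: AE_completion_iff)
  then obtain N where N: "N \<in> null_sets lborel" "{x. \<not> P x} \<subseteq> N"
    by (auto simp: eventually_ae_filter)
  then have [measurable]: "N \<in> sets lborel" by auto
  have "N \<times> UNIV \<in> null_sets (lborel \<Otimes>\<^sub>M (lborel :: 'a measure))"
       "UNIV \<times> N \<in> null_sets ((lborel :: 'a measure) \<Otimes>\<^sub>M lborel)"
    using N by (auto simp: null_sets_def lborel.emeasure_pair_measure_Times)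
  then have "N \<times> UNIV \<union> UNIV \<times> N \<in> null_sets (lborel :: ('a \<times> 'a) measure)"
    unfolding lborel_prod by auto
  then have "AE z in (lborel :: ('a \<times> 'a) measure). P (fst z) \<and> P (snd z)"
    by (rule AE_I') (use N in auto)
  then show ?thesis by (rule AE_completion)
qed

lemma Q_set_in_borel:
  assumes "open \<Omega>"
  shows "Q_set \<Omega> \<in> sets borel"
proof -
  have "closed ((UNIV - \<Omega>) \<times> (UNIV - \<Omega>))"
    using assms by (intro closed_Times) (auto simp: Compl_eq_Diff_UNIV[symmetric])
  then show ?thesis unfolding Q_set_def by auto
qed

lemma gagliardo_divide:
  "gagliardo s p w (x, y) = \<bar>w x - w y\<bar> powr p / norm (x - y) powr (real DIM('a) + p * s)"
  for x y :: "'a::euclidean_space"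
  unfolding gagliardo_def powr_minus_divide by simp

lemma gagliardo_eq_quotient_powr:
  fixes w :: "real^'n \<Rightarrow> real"
  assumes "0 < p"
  shows "(\<lambda>z. \<bar>case z of (x, y) \<Rightarrow> (w x - w y) / norm (x - y) powr ((real CARD('n) + p * s) / p)\<bar> powr p)
    = gagliardo s p w"
  using assms by (auto simp: gagliardo_divide abs_divide powr_divide powr_powr)

lemma X0_norm_eq:
  fixes w :: "real^'n \<Rightarrow> real"
  shows "X0_norm s p \<Omega> w = (LINT z:Q_set \<Omega>|lebesgue. gagliardo s p w z) powr (1 / p)"
proof -
  have "gagliardo s p w = (\<lambda>(x, y). \<bar>w x - w y\<bar> powr p / norm (x - y) powr (real CARD('n) + p * s))"
    by (auto simp: gagliardo_divide)
  then show ?thesis by (simp only: X0_norm_def)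
qed

text \<open>Members of \<open>X0\<close> vanish almost everywhere outside \<open>\<Omega>\<close>,
  so the integrand vanishes almost everywhere off \<open>Q_set \<Omega>\<close>. This links
  \<open>X0_norm\<close>, an integral over \<open>Q_set \<Omega>\<close>, to the integral over the
  whole space in \<open>Sob_const\<close>.\<close>

lemma X0_gagliardo:
  fixes w :: "real^'n \<Rightarrow> real"
  assumes p: "0 < p" and w: "w \<in> X0 s p \<Omega>"
  shows "integrable lebesgue (gagliardo s p w)"
    and "X0_norm s p \<Omega> w powr p = (LINT z|lebesgue. gagliardo s p w z)"
proof -
  have int: "set_integrable lebesgue (Q_set \<Omega>) (gagliardo s p w)"
    using w unfolding X0_def Lp_on_def mem_Collect_eq gagliardo_eq_quotient_powr[OF p] by blast
  have "AE x in lebesgue. x \<notin> \<Omega> \<longrightarrow> w x = 0" using w by (simp add: X0_def)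
  then have "AE z in lebesgue. (fst z \<notin> \<Omega> \<longrightarrow> w (fst z) = 0) \<and> (snd z \<notin> \<Omega> \<longrightarrow> w (snd z) = 0)"
    by (rule AE_lebesgue_pair)
  then have ae: "AE z in lebesgue. indicator (Q_set \<Omega>) z *\<^sub>R gagliardo s p w z = gagliardo s p w z"
    by eventually_elim (auto simp: Q_set_def gagliardo_def indicator_def mem_Times_iff case_prod_beta')
  \<comment> \<open>Measurability on the whole product is inherited from the restriction to
    \<open>Q_set \<Omega>\<close>, which agrees with it almost everywhere.\<close>
  from int have meas: "(\<lambda>z. indicator (Q_set \<Omega>) z *\<^sub>R gagliardo s p w z) \<in> borel_measurable lebesgue"
    by (auto simp: set_integrable_def)
  have meas': "gagliardo s p w \<in> borel_measurable lebesgue"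
    by (rule borel_measurable_AE[OF meas ae])
  show "integrable lebesgue (gagliardo s p w)"
    using int integrable_cong_AE[OF meas meas' ae] by (simp add: set_integrable_def)
  have "(LINT z:Q_set \<Omega>|lebesgue. gagliardo s p w z) = (LINT z|lebesgue. gagliardo s p w z)"
    unfolding set_lebesgue_integral_def by (rule integral_cong_AE[OF meas meas' ae])
  then show "X0_norm s p \<Omega> w powr p = (LINT z|lebesgue. gagliardo s p w z)"
    using p by (simp add: X0_norm_eq powr_powr gagliardo_nonneg)
qed

text \<open>A Borel representative \<open>v\<close> of \<open>w\<close> has the same energy and the
  same integrals, and the Borel version of the inequality applies to it.\<close>

lemma X0_sobolev:
  fixes w :: "real^'n \<Rightarrow> real"
  assumes sp: "0 \<le> s" "0 < p" "p * s < real CARD('n)" and \<Omega>: "open \<Omega>" "bounded \<Omega>"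
    and w: "w \<in> X0 s p \<Omega>"
  defines "k \<equiv> crit_exp CARD('n) s p"
  defines "C \<equiv> 2 powr k * (2 / unit_ball_vol (real CARD('n))) powr (1 + p * s / real CARD('n))"
  shows "integrable lebesgue (\<lambda>x. \<bar>w x\<bar> powr k)"
    and "(LINT x|lebesgue. \<bar>w x\<bar> powr k) powr (p / k) \<le> C * (LINT z|lebesgue. gagliardo s p w z)"
proof -
  define K where "K = (LINT z|lebesgue. gagliardo s p w z)"
  have K: "0 \<le> K" unfolding K_def by (intro integral_nonneg_AE) (simp add: gagliardo_nonneg)
  have k: "0 < k" unfolding k_def using sp by (intro crit_exp_pos) auto
  have wm: "w \<in> borel_measurable (completion lborel)" using w by (simp add: X0_def)
  then obtain v where v[measurable]: "v \<in> borel_measurable lborel" and wv: "AE x in lborel. w x = v x"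
    using completion_ex_borel_measurable_real by blast
  have "AE z in lebesgue. w (fst z) = v (fst z) \<and> w (snd z) = v (snd z)"
    by (rule AE_lebesgue_pair) (rule AE_completion[OF wv])
  then have "AE z in lebesgue. gagliardo s p v z = gagliardo s p w z"
    by eventually_elim (simp add: gagliardo_def case_prod_beta')
  then have "(\<integral>\<^sup>+z. ennreal (gagliardo s p v z) \<partial>lebesgue) = (\<integral>\<^sup>+z. ennreal (gagliardo s p w z) \<partial>lebesgue)"
    by (intro nn_integral_cong_AE) auto
  also have "\<dots> = ennreal K"
    unfolding K_def using X0_gagliardo(1)[OF sp(2) w]
    by (intro nn_integral_eq_integral) (auto simp: gagliardo_nonneg)
  finally have gv: "(\<integral>\<^sup>+z. ennreal (gagliardo s p v z) \<partial>lborel) = ennreal K"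
    by (simp add: nn_integral_completion)
  have "AE x in lborel. x \<notin> \<Omega> \<longrightarrow> w x = 0" using w by (simp add: X0_def AE_completion_iff)
  \<comment> \<open>Up to a null set, \<open>v\<close> is nonzero only inside the bounded set
    \<open>\<Omega>\<close>, hence on a set of finite measure.\<close>
  with wv have ae: "AE x in lborel. x \<in> {x. v x \<noteq> 0} \<longrightarrow> x \<in> \<Omega>" by eventually_elim auto
  have "emeasure lborel {x. v x \<noteq> 0} \<le> emeasure lborel \<Omega>"
    using \<Omega> by (intro emeasure_mono_AE[OF ae]) auto
  also have "\<dots> < \<infinity>" using \<Omega> by (intro emeasure_bounded_finite)
  finally have fin: "emeasure lborel {x. v x \<noteq> 0} < \<infinity>" .
  have "(\<integral>\<^sup>+x. ennreal (\<bar>w x\<bar> powr k) \<partial>lebesgue) = (\<integral>\<^sup>+x. ennreal (\<bar>v x\<bar> powr k) \<partial>lebesgue)"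
    using AE_completion[OF wv] by (intro nn_integral_cong_AE) auto
  also have "\<dots> \<le> ennreal ((C * K) powr (k / p))"
    using fractional_sobolev[of s p v K] sp fin gv K v
    by (simp add: nn_integral_completion k_def C_def)
  finally have bound: "(\<integral>\<^sup>+x. ennreal (\<bar>w x\<bar> powr k) \<partial>lebesgue) \<le> ennreal ((C * K) powr (k / p))" .
  show int: "integrable lebesgue (\<lambda>x. \<bar>w x\<bar> powr k)"
  proof (rule integrableI_nonneg)
    show "(\<lambda>x. \<bar>w x\<bar> powr k) \<in> borel_measurable lebesgue" using wm by measurable
    show "(\<integral>\<^sup>+x. ennreal (\<bar>w x\<bar> powr k) \<partial>lebesgue) < \<infinity>"
      using bound by (rule le_less_trans) simp
  qed simp
  have "ennreal (LINT x|lebesgue. \<bar>w x\<bar> powr k) \<le> ennreal ((C * K) powr (k / p))"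
    using bound int by (subst (asm) nn_integral_eq_integral) auto
  then have "(LINT x|lebesgue. \<bar>w x\<bar> powr k) \<le> (C * K) powr (k / p)"
    by (subst (asm) ennreal_le_iff) auto
  then have "(LINT x|lebesgue. \<bar>w x\<bar> powr k) powr (p / k) \<le> ((C * K) powr (k / p)) powr (p / k)"
    using sp k by (intro powr_mono2) auto
  also have "\<dots> = C * K"
    using sp k K by (simp add: powr_powr C_def)
  finally show "(LINT x|lebesgue. \<bar>w x\<bar> powr k) powr (p / k) \<le> C * (LINT z|lebesgue. gagliardo s p w z)"
    by (simp add: K_def)
qed

section \<open>The Sobolev constant as an infimum, and its positivity\<close>

lemma Sob_const_eq:
  "Sob_const s p (\<Omega> :: (real^'n) set) =
     Inf {(LINT z|lebesgue. gagliardo s p w z) /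
          (LINT x|lebesgue. \<bar>w x\<bar> powr crit_exp CARD('n) s p) powr (p / crit_exp CARD('n) s p)
         | w. w \<in> X0 s p \<Omega> \<and> \<not> (AE x in lebesgue. w x = 0)}"
  by (simp add: Sob_const_def gagliardo_def)

lemma integral_powr_pos:
  assumes "integrable M (\<lambda>x. \<bar>w x\<bar> powr k)" "\<not> (AE x in M. w x = (0::real))"
  shows "0 < (LINT x|M. \<bar>w x\<bar> powr k)"
  using assms integral_nonneg_eq_0_iff_AE[OF assms(1)]
  by (auto simp: order.strict_iff_order)

text \<open>The quotient of \<open>w\<close> is one of those in the infimum, and all of them are
  nonnegative. Integrability from \<open>X0_sobolev\<close> keeps the integral in the denominator
  from being the default \<open>0\<close>, so one may multiply through.\<close>

lemma Sob_const_le: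
  fixes w :: "real^'n \<Rightarrow> real"
  assumes sp: "0 \<le> s" "0 < p" "p * s < real CARD('n)" and \<Omega>: "open \<Omega>" "bounded \<Omega>"
    and w: "w \<in> X0 s p \<Omega>" "\<not> (AE x in lebesgue. w x = 0)"
  shows "Sob_const s p \<Omega> * (LINT x|lebesgue. \<bar>w x\<bar> powr crit_exp CARD('n) s p) powr (p / crit_exp CARD('n) s p)
    \<le> X0_norm s p \<Omega> w powr p"
proof -
  have pos: "0 < (LINT x|lebesgue. \<bar>w x\<bar> powr crit_exp CARD('n) s p)"
    using X0_sobolev(1)[OF sp \<Omega> w(1)] w(2) by (rule integral_powr_pos)
  have "Sob_const s p \<Omega> \<le> (LINT z|lebesgue. gagliardo s p w z) /
      (LINT x|lebesgue. \<bar>w x\<bar> powr crit_exp CARD('n) s p) powr (p / crit_exp CARD('n) s p)"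
    unfolding Sob_const_eq
  proof (rule cInf_lower)
    show "bdd_below {(LINT z|lebesgue. gagliardo s p w z) /
          (LINT x|lebesgue. \<bar>w x\<bar> powr crit_exp CARD('n) s p) powr (p / crit_exp CARD('n) s p)
         | w. w \<in> X0 s p \<Omega> \<and> \<not> (AE x in lebesgue. w x = 0)}"
      by (rule bdd_belowI[of _ 0]) (auto intro!: divide_nonneg_nonneg integral_nonneg_AE simp: gagliardo_nonneg)
  qed (use w in blast)
  then show ?thesis
    using pos X0_gagliardo(2)[OF sp(2) w(1)] by (simp add: field_simps)
qed

text \<open>Provides a nonzero member of \<open>X0\<close>, without which the infimum in
  \<open>Sob_const\<close> would range over the empty set. The tent is positive on a ball, which has
  positive measure.\<close>

lemma tent_in_X0:
  assumes sp: "0 < s" "s < 1" "0 < p" and \<Omega>: "open \<Omega>" and \<delta>: "0 < \<delta>" "\<delta> \<le> 1" "ball 0 \<delta> \<subseteq> \<Omega>"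
  shows "(\<lambda>x::real^'n. max 0 (\<delta> - norm x)) \<in> X0 s p \<Omega>"
    and "\<not> (AE x in lebesgue. max 0 (\<delta> - norm (x::real^'n)) = 0)"
proof -
  define \<phi> where "\<phi> = (\<lambda>x::real^'n. max 0 (\<delta> - norm x))"
  have [measurable]: "\<phi> \<in> borel_measurable borel" unfolding \<phi>_def by measurable
  have meas: "\<phi> \<in> borel_measurable lebesgue" by (intro measurable_completion) simp
  have gint: "integrable lebesgue (gagliardo s p \<phi>)"
  proof (subst integrable_completion)
    show "gagliardo s p \<phi> \<in> borel_measurable lborel"
      unfolding lborel_prod[symmetric] by measurable
    then show "integrable lborel (gagliardo s p \<phi>)"
      using tent_gagliardo_less_top[OF sp \<delta>(1,2), where 'a = "real^'n"]
      by (intro integrableI_nonneg) (auto simp: gagliardo_nonneg \<phi>_def)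
  qed
  have pint: "integrable lebesgue (\<lambda>x. \<bar>\<phi> x\<bar> powr p)"
  proof (subst integrable_completion)
    have "\<delta> - norm x \<le> 1" for x :: "real^'n" using \<delta> norm_ge_zero[of x] by linarith
    then have "(\<integral>\<^sup>+x. ennreal (\<bar>\<phi> x\<bar> powr p) \<partial>lborel) \<le> (\<integral>\<^sup>+x. 1 * indicator (ball (0::real^'n) \<delta>) x \<partial>lborel)"
      using \<delta> sp by (intro nn_integral_mono) (auto simp: \<phi>_def indicator_def intro!: ennreal_leI powr_le1)
    also have "\<dots> < \<infinity>" using \<delta> by (simp add: emeasure_ball)
    finally show "integrable lborel (\<lambda>x. \<bar>\<phi> x\<bar> powr p)"
      by (intro integrableI_nonneg) auto
  qed measurable
  have Q: "Q_set \<Omega> \<in> sets lebesgue" using Q_set_in_borel[OF \<Omega>] by simp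
  have O: "\<Omega> \<in> sets lebesgue" using \<Omega> by simp
  have qm: "(\<lambda>(x, y). (\<phi> x - \<phi> y) / norm (x - y) powr ((real CARD('n) + p * s) / p)) \<in> borel_measurable lebesgue"
    by (intro measurable_completion, unfold lborel_prod[symmetric]) measurable
  have "\<phi> \<in> X0 s p \<Omega>"
    unfolding X0_def Lp_on_def
  proof (intro CollectI conjI)
    show "set_integrable lebesgue (Q_set \<Omega>) (\<lambda>x. \<bar>case x of (x, y) \<Rightarrow> (\<phi> x - \<phi> y) / norm (x - y) powr ((real CARD('n) + p * s) / p)\<bar> powr p)"
      using integrable_mult_indicator[OF Q gint]
      unfolding gagliardo_eq_quotient_powr[OF sp(3)] by (simp add: set_integrable_def)
    show "set_integrable lebesgue \<Omega> (\<lambda>x. \<bar>\<phi> x\<bar> powr p)"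
      using integrable_mult_indicator[OF O pint] by (simp add: set_integrable_def)
    show "AE x in lebesgue. x \<notin> \<Omega> \<longrightarrow> \<phi> x = 0"
      using \<delta> by (intro AE_I2) (force simp: \<phi>_def subset_iff max_def)
  qed (use meas qm Q O in \<open>auto simp: set_borel_measurable_def\<close>)
  then show "(\<lambda>x::real^'n. max 0 (\<delta> - norm x)) \<in> X0 s p \<Omega>" by (simp add: \<phi>_def)
  show "\<not> (AE x in lebesgue. max 0 (\<delta> - norm (x::real^'n)) = 0)"
  proof
    assume "AE x in lebesgue. max 0 (\<delta> - norm (x::real^'n)) = 0"
    then have "AE x in lborel. x \<notin> ball (0::real^'n) \<delta>"
      unfolding AE_completion_iff by eventually_elim auto
    then have "emeasure lborel (ball (0::real^'n) \<delta>) = 0"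
      by (subst (asm) AE_iff_measurable[of "ball 0 \<delta>"]) auto
    then show False
      using \<delta> unit_ball_vol_pos[of "real CARD('n)"] by (simp add: emeasure_ball del: unit_ball_vol_pos)
  qed
qed

text \<open>By \<open>X0_sobolev\<close> every quotient is at least \<open>1 / C\<close>, and the
  tent shows that there is one.\<close>

lemma Sob_const_pos:
  fixes \<Omega> :: "(real^'n) set"
  assumes sp: "0 < s" "s < 1" "0 < p" "p * s < real CARD('n)" and \<Omega>: "open \<Omega>" "bounded \<Omega>" "0 \<in> \<Omega>"
  shows "0 < Sob_const s p \<Omega>"
proof -
  define k where "k = crit_exp CARD('n) s p"
  define C where "C = 2 powr k * (2 / unit_ball_vol (real CARD('n))) powr (1 + p * s / real CARD('n))"
  have "unit_ball_vol (real CARD('n)) \<noteq> 0"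
    using unit_ball_vol_pos[of "real CARD('n)"] by linarith
  then have C: "0 < C" unfolding C_def by (intro mult_pos_pos) simp_all
  obtain \<delta>' where "0 < \<delta>'" "ball 0 \<delta>' \<subseteq> \<Omega>" using \<Omega> openE by blast
  then have \<delta>: "0 < min 1 \<delta>'" "min 1 \<delta>' \<le> 1" "ball 0 (min 1 \<delta>') \<subseteq> \<Omega>" by auto
  have "1 / C \<le> Sob_const s p \<Omega>"
    unfolding Sob_const_eq
  proof (rule cInf_greatest)
    show "{(LINT z|lebesgue. gagliardo s p w z) /
          (LINT x|lebesgue. \<bar>w x\<bar> powr crit_exp CARD('n) s p) powr (p / crit_exp CARD('n) s p)
         | w. w \<in> X0 s p \<Omega> \<and> \<not> (AE x in lebesgue. w x = 0)} \<noteq> {}"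
      using tent_in_X0[OF sp(1-3) \<Omega>(1) \<delta>] by blast
  next
    fix t
    assume "t \<in> {(LINT z|lebesgue. gagliardo s p w z) /
          (LINT x|lebesgue. \<bar>w x\<bar> powr crit_exp CARD('n) s p) powr (p / crit_exp CARD('n) s p)
         | w. w \<in> X0 s p \<Omega> \<and> \<not> (AE x in lebesgue. w x = 0)}"
    then obtain w where w: "w \<in> X0 s p \<Omega>" "\<not> (AE x in lebesgue. w x = 0)"
      and t: "t = (LINT z|lebesgue. gagliardo s p w z) / (LINT x|lebesgue. \<bar>w x\<bar> powr k) powr (p / k)"
      by (auto simp: k_def)
    note sob = X0_sobolev[OF less_imp_le[OF sp(1)] sp(3,4) \<Omega>(1,2) w(1), folded k_def, folded C_def]
    have "0 < (LINT x|lebesgue. \<bar>w x\<bar> powr k)" using sob(1) w(2) by (rule integral_powr_pos)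
    then show "1 / C \<le> t" using sob(2) C by (simp add: t field_simps)
  qed
  then show ?thesis using C by (smt (verit) divide_pos_pos)
qed

section \<open>The lower bound for the norm on the lower part of the Nehari manifold\<close>

lemma AE_pos_imp_not_AE_zero:
  fixes w :: "'a::euclidean_space \<Rightarrow> real"
  assumes "open \<Omega>" "\<Omega> \<noteq> {}" "AE x in lebesgue. x \<in> \<Omega> \<longrightarrow> 0 < w x"
  shows "\<not> (AE x in lebesgue. x \<in> \<Omega> \<longrightarrow> w x = 0)"
proof
  assume "AE x in lebesgue. x \<in> \<Omega> \<longrightarrow> w x = 0"
  with assms(3) have "AE x in lebesgue. x \<notin> \<Omega>" by eventually_elim auto
  then have "AE x in lborel. x \<notin> \<Omega>" unfolding AE_completion_iff .
  then have "\<Omega> \<in> null_sets lborel"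
    using assms(1) by (subst (asm) AE_iff_null_sets[symmetric]) auto
  then have "negligible \<Omega>"
    by (auto simp: negligible_iff_null_sets null_sets_completionI)
  then show False using assms open_not_negligible by blast
qed

text \<open>A nonnegative integrable function has integral zero only if it vanishes almost
  everywhere, which positivity on a nonempty open set excludes. This serves for the norm of
  \<open>a\<close>.\<close>

lemma Lp_norm_on_pos:
  fixes w :: "'a::euclidean_space \<Rightarrow> real"
  assumes "open \<Omega>" "\<Omega> \<noteq> {}" "AE x in lebesgue. x \<in> \<Omega> \<longrightarrow> 0 < w x" "w \<in> Lp_on t \<Omega>"
  shows "0 < Lp_norm_on t \<Omega> w"
proof -
  have int: "integrable lebesgue (\<lambda>x. indicator \<Omega> x *\<^sub>R (\<bar>w x\<bar> powr t))"
    using assms(4) by (simp add: Lp_on_def set_integrable_def)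
  have "\<not> (AE x in lebesgue. indicator \<Omega> x *\<^sub>R (\<bar>w x\<bar> powr t) = 0)"
  proof
    assume "AE x in lebesgue. indicator \<Omega> x *\<^sub>R (\<bar>w x\<bar> powr t) = 0"
    then have "AE x in lebesgue. x \<in> \<Omega> \<longrightarrow> w x = 0" by eventually_elim auto
    with AE_pos_imp_not_AE_zero[OF assms(1-3)] show False by simp
  qed
  then have "(LINT x:\<Omega>|lebesgue. \<bar>w x\<bar> powr t) \<noteq> 0"
    using integral_nonneg_eq_0_iff_AE[OF int] by (simp add: set_lebesgue_integral_def)
  then show ?thesis by (simp add: Lp_norm_on_def)
qed

text \<open>Hoelder's inequality with the conjugate exponents \<open>k / (k - 1 - r)\<close> and
  \<open>k / (r + 1)\<close>. The second turns the power \<open>r + 1\<close> of the positive part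
  of \<open>w\<close> into its k-th power, which is at most that of the absolute value.\<close>

lemma Nehari_term_le:
  fixes w b :: "real^'n \<Rightarrow> real"
  assumes sp: "0 \<le> s" "0 < p" "p * s < real CARD('n)" and \<Omega>: "open \<Omega>" "bounded \<Omega>"
    and r: "0 < r" "r < crit_exp CARD('n) s p - 1" and w: "w \<in> X0 s p \<Omega>"
    and b: "b \<in> Lp_on (crit_exp CARD('n) s p / (crit_exp CARD('n) s p - 1 - r)) \<Omega>"
  shows "(LINT x:\<Omega>|lebesgue. b x * (max (w x) 0) powr (r + 1))
    \<le> b_norm s p r \<Omega> b * (LINT x|lebesgue. \<bar>w x\<bar> powr crit_exp CARD('n) s p) powr ((r + 1) / crit_exp CARD('n) s p)"
proof -
  define k where "k = crit_exp CARD('n) s p"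
  define g where "g x = (max (w x) 0) powr (r + 1)" for x
  note int = X0_sobolev(1)[OF sp \<Omega> w, folded k_def]
  have k: "r + 1 < k" using r by (simp add: k_def)
  have [measurable]: "w \<in> borel_measurable lebesgue" "\<Omega> \<in> sets lebesgue" 
    using w \<Omega> by (auto simp: X0_def)
  have gm: "g \<in> borel_measurable lebesgue" unfolding g_def by measurable
  have gk: "\<bar>g x\<bar> powr (k / (r + 1)) = (max (w x) 0) powr k" for x
    using r by (simp add: g_def powr_powr)
  have le: "indicator \<Omega> x * (max (w x) 0) powr k \<le> \<bar>w x\<bar> powr k" for x
    using k r by (auto simp: indicator_def intro!: powr_mono2)
  have gint: "integrable lebesgue (\<lambda>x. indicator \<Omega> x * (max (w x) 0) powr k)"
    by (rule Bochner_Integration.integrable_bound[OF int]) (use le in auto)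
  have g: "g \<in> Lp_on (k / (r + 1)) \<Omega>"
    using gint gm by (auto simp: Lp_on_def gk set_integrable_def set_borel_measurable_def)
  have "(LINT x:\<Omega>|lebesgue. b x * g x) \<le> Lp_norm_on (k / (k - 1 - r)) \<Omega> b * Lp_norm_on (k / (r + 1)) \<Omega> g"
  proof (rule set_integral_powr_Holder)
    show "1 / (k / (k - 1 - r)) + 1 / (k / (r + 1)) = 1" using k r by (simp add: divide_simps)
  qed (use b g k r in \<open>auto simp: k_def\<close>)
  also have "\<dots> \<le> Lp_norm_on (k / (k - 1 - r)) \<Omega> b * (LINT x|lebesgue. \<bar>w x\<bar> powr k) powr ((r + 1) / k)"
  proof (rule mult_left_mono)
    have "(LINT x:\<Omega>|lebesgue. (max (w x) 0) powr k) \<le> (LINT x|lebesgue. \<bar>w x\<bar> powr k)"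
      using integral_mono[OF gint int le] by (simp add: set_lebesgue_integral_def)
    moreover have "0 \<le> (LINT x:\<Omega>|lebesgue. (max (w x) 0) powr k)"
      by (simp add: set_lebesgue_integral_def)
    ultimately show "Lp_norm_on (k / (r + 1)) \<Omega> g \<le> (LINT x|lebesgue. \<bar>w x\<bar> powr k) powr ((r + 1) / k)"
      using k r by (simp add: Lp_norm_on_def gk powr_mono2)
  qed (simp add: Lp_norm_on_def)
  finally show ?thesis by (simp add: b_norm_def k_def g_def)
qed

text \<open>If the norm of \<open>b\<close> vanishes, then \<open>1 / b_norm s p r \<Omega> b\<close> and hence the constant is \<open>0\<close>.\<close>

lemma b_norm_pos_if_Lambda_const_pos:
  assumes "0 < Lambda_const s p q r \<Omega> a b"
  shows "0 < b_norm s p r \<Omega> b"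
proof -
  have "b_norm s p r \<Omega> b \<noteq> 0" using assms by (auto simp: Lambda_const_def)
  then show ?thesis by (simp add: b_norm_def Lp_norm_on_def)
qed

text \<open>\<open>N\<close> stands for the norm of the solution, \<open>A\<close> for its integral
  of the k-th power, and \<open>a\<close>, \<open>b\<close> for the norms of the coefficients.
  Combining the two inequalities and cancelling \<open>N powr p\<close> leaves
  \<open>X < N powr \<epsilon>\<close>. The left side of the claim is
  \<open>X powr (1 / \<epsilon>)\<close>: the powers of \<open>a\<close> and of
  \<open>1 + (p - 1 + q) / \<epsilon>\<close> in the two constants cancel.\<close>

lemma Nehari_bound_algebra:
  fixes p q r \<epsilon> S N a b lam k A :: real
  assumes pq: "1 < p" "0 < q" "0 < \<epsilon>" and r: "r = p - 1 + \<epsilon>"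
    and pos: "0 < S" "0 < N" "0 < a" "0 < b" "0 < lam" "0 < A" "0 < k"
    and nehari: "(p - 1 + q) * N powr p < lam * (r + q) * (b * A powr ((r + 1) / k))"
    and sob: "S * A powr (p / k) \<le> N powr p"
  shows "(1 + (p - 1 + q) / \<epsilon>) powr (1 / (p - 1 + q)) * a powr (1 / (p - 1 + q))
      * (1 / S powr (1 / p)) powr ((1 - q) / (p - 1 + q))
      * (((p - 1 + q) / (r + q) * ((r - p + 1) / (r + q)) powr ((r - p + 1) / (p - 1 + q)) * (1 / b)
          * (S powr (r + q) / a powr (r - p + 1)) powr (1 / (p - 1 + q))) / lam) powr (1 / \<epsilon>) < N"
    (is "?L < N")
proof -
  define c where "c = p - 1 + q"
  have c: "0 < c" using pq by (simp add: c_def)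
  have rq: "r + q = c + \<epsilon>" and rp: "r - p + 1 = \<epsilon>" and r1: "r + 1 = p + \<epsilon>"
    by (simp_all add: r c_def)
  have q: "q = c - p + 1" by (simp add: c_def)
  define X where "X = c / (c + \<epsilon>) / (lam * b) * S powr ((p + \<epsilon>) / p)"
  have X: "0 < X" using c pq pos by (simp add: X_def)
  have L: "?L = X powr (1 / \<epsilon>)"
  proof -
    have nz: "0 < c + \<epsilon>" "c + \<epsilon> \<noteq> 0" "1 + c / \<epsilon> \<noteq> 0"
      using c pq by (auto simp: add_pos_pos add_nonneg_eq_0_iff)
    have L0: "0 < ?L" using pq pos c nz unfolding rp rq c_def[symmetric]
      by (intro mult_pos_pos) (auto simp del: times_divide_eq_left times_divide_eq_right)
    have eq: "1 + c / \<epsilon> = (c + \<epsilon>) / \<epsilon>" using pq by (simp add: field_simps)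
    \<comment> \<open>Both sides are positive products of powers, so comparing logarithms reduces
      the identity to a rational one in the exponents.\<close>
    have "ln ?L = ln (X powr (1 / \<epsilon>))"
      unfolding rp rq c_def[symmetric] X_def eq using pq pos c nz
      by (simp add: ln_mult ln_div add_pos_pos, simp add: q divide_simps, simp add: algebra_simps)
    then show ?thesis using L0 X by (subst (asm) ln_inj_iff) auto
  qed
  have "A powr (p / k) \<le> N powr p / S" using sob pos by (simp add: field_simps)
  \<comment> \<open>The exponent \<open>(p + \<epsilon>) / p\<close> turns \<open>p / k\<close> into
    \<open>(r + 1) / k\<close>, the power of \<open>A\<close> in the Nehari inequality.\<close>
  then have "(A powr (p / k)) powr ((p + \<epsilon>) / p) \<le> (N powr p / S) powr ((p + \<epsilon>) / p)"
    using pq by (intro powr_mono2) auto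
  then have "A powr ((p + \<epsilon>) / k) \<le> N powr (p + \<epsilon>) / S powr ((p + \<epsilon>) / p)"
    using pq pos by (simp add: powr_powr powr_divide)
  then have "lam * (c + \<epsilon>) * (b * A powr ((p + \<epsilon>) / k)) \<le> lam * (c + \<epsilon>) * (b * (N powr (p + \<epsilon>) / S powr ((p + \<epsilon>) / p)))"
    using pos c pq by (intro mult_left_mono) auto
  with nehari have "c * N powr p < lam * (c + \<epsilon>) * (b * (N powr p * N powr \<epsilon> / S powr ((p + \<epsilon>) / p)))"
    unfolding rq r1 c_def[symmetric] powr_add by linarith
  then have "N powr p * (c * S powr ((p + \<epsilon>) / p)) < N powr p * (N powr \<epsilon> * ((c + \<epsilon>) * (lam * b)))"
    using pos by (simp add: pos_less_divide_eq mult_ac)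
  then have "c * S powr ((p + \<epsilon>) / p) < N powr \<epsilon> * ((c + \<epsilon>) * (lam * b))"
    using pos by simp
  moreover have "0 < (c + \<epsilon>) * (lam * b)" using pos c pq by simp
  ultimately have "X < N powr \<epsilon>"
    by (simp add: X_def pos_divide_less_eq)
  then have "X powr (1 / \<epsilon>) < (N powr \<epsilon>) powr (1 / \<epsilon>)"
    using X pq by (intro powr_less_mono2) auto
  then show ?thesis using L pos pq by (simp add: powr_powr)
qed

theorem theorem2p3:
  fixes \<Omega> :: "(real^'n) set" and a b :: "real^'n \<Rightarrow> real" and s p q :: real
  assumes "0 < s" "s < 1" and "real CARD('n) > p * s"
    and "0 < q" "q < 1" "q < p - 1"
    and "bounded_smooth_domain \<Omega>" "0 \<in> \<Omega>"
    and "AE x in lebesgue. x \<in> \<Omega> \<longrightarrow> 0 < a x"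
    and "a \<in> Lp_on (crit_exp CARD('n) s p / (crit_exp CARD('n) s p - 1 + q)) \<Omega>"
    and "\<not> (AE x in lebesgue. x \<in> \<Omega> \<longrightarrow> b x \<le> 0)"
    and "\<not> (AE x in lebesgue. x \<in> \<Omega> \<longrightarrow> 0 \<le> b x)"
  shows "(\<forall>\<epsilon> r lam W.
            0 < \<epsilon> \<and> r = p - 1 + \<epsilon> \<and> r < crit_exp CARD('n) s p - 1 \<and>
            b \<in> Lp_on (crit_exp CARD('n) s p / (crit_exp CARD('n) s p - 1 - r)) \<Omega> \<and>
            0 < lam \<and> lam < Lambda_const s p q r \<Omega> a b \<and>
            W \<in> Nehari_minus s p q r \<Omega> a b lam \<and> weak_solution s p q r \<Omega> a b lam W \<longrightarrow>
            X0_norm s p \<Omega> W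
              > C_const s p q \<Omega> a \<epsilon> * (Lambda_const s p q r \<Omega> a b / lam) powr (1 / \<epsilon>)) \<and>
         filterlim (\<lambda>\<epsilon>. C_const s p q \<Omega> a \<epsilon>) at_top (at_right 0)"
proof (intro conjI allI impI, elim conjE)
  have p: "1 < p" "0 < p" and s: "0 \<le> s" using assms by auto
  have \<Omega>: "open \<Omega>" "bounded \<Omega>" "\<Omega> \<noteq> {}"
    using assms(7) by (auto simp: bounded_smooth_domain_def)
  have S: "0 < Sob_const s p \<Omega>"
    using assms p \<Omega> by (intro Sob_const_pos) auto
  have a: "0 < a_norm s p q \<Omega> a"
    unfolding a_norm_def using assms \<Omega> by (intro Lp_norm_on_pos) auto
  define k where "k = crit_exp CARD('n) s p"
  have k: "0 < k" unfolding k_def using p s assms(3) by (intro crit_exp_pos) auto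
  {
    fix \<epsilon> r lam W
    assume e: "0 < \<epsilon>" and r: "r = p - 1 + \<epsilon>" "r < crit_exp CARD('n) s p - 1"
      and b: "b \<in> Lp_on (crit_exp CARD('n) s p / (crit_exp CARD('n) s p - 1 - r)) \<Omega>"
      and lam: "0 < lam" "lam < Lambda_const s p q r \<Omega> a b"
      and W: "W \<in> Nehari_minus s p q r \<Omega> a b lam" "weak_solution s p q r \<Omega> a b lam W"
    define A where "A = (LINT x|lebesgue. \<bar>W x\<bar> powr k)"
    have WX: "W \<in> X0 s p \<Omega>" and Wpos: "AE x in lebesgue. x \<in> \<Omega> \<longrightarrow> 0 < W x"
      using W(2) by (auto simp: weak_solution_def)
    \<comment> \<open>The solution is positive almost everywhere on the nonempty open
      \<open>\<Omega>\<close>, so it is not the zero class and is admissible in the infimum.\<close>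
    have Wnz: "\<not> (AE x in lebesgue. W x = 0)"
    proof
      assume "AE x in lebesgue. W x = 0"
      then have "AE x in lebesgue. x \<in> \<Omega> \<longrightarrow> W x = 0" by eventually_elim simp
      with AE_pos_imp_not_AE_zero[OF \<Omega>(1,3) Wpos] show False by simp
    qed
    have bpos: "0 < b_norm s p r \<Omega> b"
      using lam by (intro b_norm_pos_if_Lambda_const_pos[of s p q r \<Omega> a b]) auto
    have A: "0 < A"
      unfolding A_def k_def using X0_sobolev(1)[OF s p(2) assms(3) \<Omega>(1,2) WX] Wnz by (rule integral_powr_pos)
    have sob: "Sob_const s p \<Omega> * A powr (p / k) \<le> X0_norm s p \<Omega> W powr p"
      unfolding A_def k_def by (rule Sob_const_le[OF s p(2) assms(3) \<Omega>(1,2) WX Wnz])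
    moreover have "0 < Sob_const s p \<Omega> * A powr (p / k)" using S A by simp
    \<comment> \<open>The Sobolev inequality bounds the p-th power of the norm below by a positive
      number, while \<open>0 powr p\<close> is \<open>0\<close>.\<close>
    ultimately have "X0_norm s p \<Omega> W \<noteq> 0" by auto
    then have N: "0 < X0_norm s p \<Omega> W" by (simp add: X0_norm_def)
    have "(p - 1 + q) * X0_norm s p \<Omega> W powr p
       < lam * (r + q) * (LINT x:\<Omega>|lebesgue. b x * (max (W x) 0) powr (r + 1))"
      using W(1) by (simp add: Nehari_minus_def)
    also have "\<dots> \<le> lam * (r + q) * (b_norm s p r \<Omega> b * A powr ((r + 1) / k))"
      unfolding A_def k_def using lam e p r assms(4) b
      by (intro mult_left_mono Nehari_term_le s assms(3) \<Omega> WX) auto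
    finally have nehari: "(p - 1 + q) * X0_norm s p \<Omega> W powr p
       < lam * (r + q) * (b_norm s p r \<Omega> b * A powr ((r + 1) / k))" .
    show "C_const s p q \<Omega> a \<epsilon> * (Lambda_const s p q r \<Omega> a b / lam) powr (1 / \<epsilon>) < X0_norm s p \<Omega> W"
      unfolding C_const_def Lambda_const_def
      by (rule Nehari_bound_algebra[OF p(1) assms(4) e r(1) S N a bpos lam(1) A k nehari sob])
  }
  show "filterlim (\<lambda>\<epsilon>. C_const s p q \<Omega> a \<epsilon>) at_top (at_right 0)"
  proof -
    define c where "c = p - 1 + q"
    have c: "0 < c" using p assms(4) by (simp add: c_def)
    define M where "M = a_norm s p q \<Omega> a powr (1 / c) * (1 / Sob_const s p \<Omega> powr (1 / p)) powr ((1 - q) / c)"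
    have M: "0 < M" using a S by (simp add: M_def)
    \<comment> \<open>Only the factor \<open>(1 + c / \<epsilon>) powr (1 / c)\<close> depends on
      \<open>\<epsilon>\<close>; it diverges since \<open>c\<close> is positive, and
      \<open>M\<close> is a positive constant because \<open>a\<close> has positive norm and the
      Sobolev constant is positive.\<close>
    have "filterlim (\<lambda>\<epsilon>. M * (1 + c / \<epsilon>) powr (1 / c)) at_top (at_right 0)"
      using c M by real_asymp
    then show ?thesis by (simp add: C_const_def M_def c_def mult_ac)
  qed
qed

end
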